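(* Consider two ergodic unreliable Jackson networks on the same node set with state processes $\mathbf Z$ and $\mathbf Z'$, with the same arrival and service intensities and the same failure-repair rates, and with routing matrices $R$ and $R'$. Assume that the equations $x=x\cdot R$ and $x=x\cdot R'$ have the same normalized solution $\xi$, and that both networks follow rerouting mechanisms $(R^D)_{D\subseteq\tilde J}$ and $(R'^D)_{D\subseteq\tilde J}$ satisfying the rerouting assumption. If $R^D\prec_{pd}R'^D$ for all $D\subseteq\tilde J$ (also for $D=\emptyset$), then $$\mathrm{Gap}(Q^{\mathbf Z'})\le\mathrm{Gap}(Q^{\mathbf Z}).$$
   Context: Notation: $\mathbb N=\{0,1,2,\dots\}$, $\tilde J=\{1,\dots,J\}$, $\tilde J_0=\{0,1,\dots,J\}$; $\subset$ denotes strict inclusion; $e_j$ is the $j$-th standard base vector of $\mathbb N^J$. $\langle f,g\rangle_{\nu}=\int fg\,d\nu$. Network data: an arrival intensity $\lambda>0$; an irreducible stochastic routing matrix $R=[r_{ij}]_{i,j\in\tilde J_0}$ ($r_{00}\ge 0$ allowed; node $0$ is source and sink); service rates $\mu_j(k)>0$ for $k\ge1$, $\mu_j(0)=0$, with $\sup_{j,k}\mu_j(k)<\infty$. The traffic equations $\eta_j=\lambda r_{0j}+\sum_{i=1}^J\eta_ir_{ij}$, $j\in\tilde J$, have a unique solution $(\eta_j)_{j\in\tilde J}$; put $\eta_0=\lambda$. The network (without breakdowns) is assumed ergodic, i.e. $C_j:=\sum_{m\ge0}\prod_{k=1}^{m}\eta_j/\mu_j(k)<\infty$ for all $j$, and $\pi(n)=\prod_{j=1}^J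 C_j^{-1}\prod_{k=1}^{n_j}\frac{\eta_j}{\mu_j(k)}$ on $\mathbb N^J$. Breakdown and repair: functions $A,B:2^{\tilde J}\to[0,\infty)$ with $A(\emptyset)=B(\emptyset)=1$, $A(I)/A(D)<\infty$ for all $D\subset I\subseteq\tilde J$ and $B(D)/B(H)<\infty$ for all $H\subset D\subseteq\tilde J$ (conventions $0/0=0$, $1/0=\infty$). $\mathbf Y$ is the Markov process on $2^{\tilde J}$ (its state is the set of broken down nodes) with rates (failure-repair rates) $q^{\mathbf Y}(D,I)=A(I)/A(D)$ for $D\subset I$, $q^{\mathbf Y}(D,H)=B(D)/B(H)$ for $H\subset D$, other off-diagonal rates zero, and generator $(Q^{\mathbf Y}h)(D)=\sum_{H\subset D}q^{\mathbf Y}(D,H)(h(H)-h(D))+\sum_{I\supset D}q^{\mathbf Y}(D,I)(h(I)-h(D))$. It is reversible with respect to the probability $\hat\pi(D)=\hat C^{-1}A(D)/B(D)$. Rerouting assumption: for each $D\subseteq\tilde J$ there is a stochastic matrix $R^D=[r^D_{ij}]_{i,j\in\tilde J_0\setminus D}$, $R^\emptyset=R$, such that $\eta_j=\lambda r^D_{0j}+\sum_{i\in\tilde J\setminus D}\eta_ir^D_{ij}$ for all $j\in\tilde J\setminus D$ (same $\eta$ for every $D$). Then $(\eta_j)_{j\in\tilde J_0\setminus D}$ solves $x=x\cdot R^D$; its normalization is $\xi^D_j=\eta_j/\sum_{k\in\tilde J_0\setminus D}\eta_k$, $j\in\tilde J_0\setminus D$. Here $\xi=\xi^\emptyset$; because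 $\lambda$ and $\xi$ are common, the two networks have the same $\eta$ and the same $\xi^D$. Unreliable Jackson network process $\mathbf Z=(\mathbf Y,\mathbf X)$: the Markov process on $\tilde{\mathbb E}=2^{\tilde J}\times\mathbb N^J$ with generator $(Q^{\mathbf Z}f)(D,n)=\sum_{j\in\tilde J\setminus D}\lambda r^D_{0j}(f(D,n+e_j)-f(D,n))+\sum_{j\in\tilde J\setminus D}\mu_j(n_j)r^D_{j0}(f(D,n-e_j)-f(D,n))+\sum_{j\in\tilde J\setminus D}\mu_j(n_j)\sum_{i\in\tilde J\setminus D}r^D_{ji}(f(D,n-e_j+e_i)-f(D,n))+(Q^{\mathbf Y}f(\cdot,n))(D)$. Terms with factor $\mu_j(0)$ are zero. If $\mathbf Z$ is ergodic, its unique stationary distribution is known to be $\tilde\pi(D,n)=\hat\pi(D)\pi(n)$. $\mathbf Z'$ is built in the same way from the same $\lambda,\mu_j,A,B$ with $R',(R'^D)$. Spectral gap: $\mathrm{Gap}(Q^{\mathbf Z})=\inf\{\langle f,-Q^{\mathbf Z}f\rangle_{\tilde\pi}: f\in L^2(\tilde{\mathbb E},\tilde\pi),\ \tilde\pi(f)=0,\ \langle f,f\rangle_{\tilde\pi}=1\}$, where $\tilde\pi(f)=\int f\,d\tilde\pi$. Positive semidefinite order: for transition matrices $P,P'$ on a finite set with common invariant probability vector $\nu$, $P\prec_{pd}P'$ means that $P'-P$ is positive semidefinite, i.e. $\langle h,(P'-P)h\rangle_\nu=\sum_x\nu(x)h(x)((P'-P)h)(x)\ge0$ for all real $h$; for $R^D,R'^D$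 take $\nu=\xi^D$. *)

theory Defs
  imports "HOL-Analysis.Analysis"
begin

text \<open>
  The nodes are \<open>{1..J}\<close>, and \<open>0\<close> is the source and sink.  A queue length vector in
  \<open>\<nat>\<^sup>J\<close> is a function on \<open>nat\<close> that vanishes outside \<open>{1..J}\<close>.
\<close>

section \<open>Routing matrices on a finite index set\<close>

definition stochastic_on :: "nat set \<Rightarrow> (nat \<Rightarrow> nat \<Rightarrow> real) \<Rightarrow> bool" where
  "stochastic_on S P \<longleftrightarrow> (\<forall>i\<in>S. (\<forall>j\<in>S. P i j \<ge> 0) \<and> (\<Sum>j\<in>S. P i j) = 1)"

definition irreducible_on :: "nat set \<Rightarrow> (nat \<Rightarrow> nat \<Rightarrow> real) \<Rightarrow> bool" where
  "irreducible_on S P \<longleftrightarrow> (\<forall>i\<in>S. \<forall>j\<in>S. (i, j) \<in> {(k, l). k \<in> S \<and> l \<in> S \<and> P k l > 0}\<^sup>*)"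

definition invariant_prob_on :: "nat set \<Rightarrow> (nat \<Rightarrow> nat \<Rightarrow> real) \<Rightarrow> (nat \<Rightarrow> real) \<Rightarrow> bool" where
  "invariant_prob_on S P x \<longleftrightarrow>
     (\<forall>j\<in>S. x j \<ge> 0) \<and> (\<Sum>j\<in>S. x j) = 1 \<and> (\<forall>j\<in>S. x j = (\<Sum>i\<in>S. x i * P i j))"

definition pd_le :: "nat set \<Rightarrow> (nat \<Rightarrow> real) \<Rightarrow> (nat \<Rightarrow> nat \<Rightarrow> real) \<Rightarrow> (nat \<Rightarrow> nat \<Rightarrow> real) \<Rightarrow> bool" where
  "pd_le S \<nu> P P' \<longleftrightarrow>
     (\<forall>h :: nat \<Rightarrow> real. (\<Sum>x\<in>S. \<nu> x * h x * (\<Sum>y\<in>S. (P' x y - P x y) * h y)) \<ge> 0)"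

section \<open>Network data\<close>

text \<open>The last conjunct is \<open>C\<^sub>j < \<infinity>\<close>, that is, ergodicity of the network without breakdowns.\<close>

definition jackson_network ::
  "nat \<Rightarrow> real \<Rightarrow> (nat \<Rightarrow> nat \<Rightarrow> real) \<Rightarrow> (nat \<Rightarrow> nat \<Rightarrow> real) \<Rightarrow> (nat \<Rightarrow> real) \<Rightarrow> bool" where
  "jackson_network J lam mu R eta \<longleftrightarrow>
     J \<ge> 1 \<and> lam > 0 \<and>
     stochastic_on {0..J} R \<and> irreducible_on {0..J} R \<and>
     (\<forall>j\<in>{1..J}. mu j 0 = 0 \<and> (\<forall>k\<ge>1. mu j k > 0)) \<and>
     bdd_above (\<Union>j\<in>{1..J}. range (mu j)) \<and>
     eta 0 = lam \<and>
     (\<forall>j\<in>{1..J}. eta j = lam * R 0 j + (\<Sum>i\<in>{1..J}. eta i * R i j)) \<and>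
     (\<forall>j\<in>{1..J}. summable (\<lambda>m. \<Prod>k=1..m. eta j / mu j k))"

text \<open>
  The quotients are taken in \<open>ennreal\<close>, where \<open>0 / 0 = 0\<close> and \<open>1 / 0 = \<infinity>\<close>.  When they are
  finite they agree with the quotients of reals that occur in the failure and repair rates below.
\<close>

definition failure_repair :: "nat \<Rightarrow> (nat set \<Rightarrow> real) \<Rightarrow> (nat set \<Rightarrow> real) \<Rightarrow> bool" where
  "failure_repair J A B \<longleftrightarrow>
     (\<forall>D. D \<subseteq> {1..J} \<longrightarrow> A D \<ge> 0 \<and> B D \<ge> 0) \<and> A {} = 1 \<and> B {} = 1 \<and>
     (\<forall>D I. D \<subset> I \<and> I \<subseteq> {1..J} \<longrightarrow> ennreal (A I) / ennreal (A D) < \<infinity>) \<and>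
     (\<forall>H D. H \<subset> D \<and> D \<subseteq> {1..J} \<longrightarrow> ennreal (B D) / ennreal (B H) < \<infinity>)"

definition rerouting ::
  "nat \<Rightarrow> real \<Rightarrow> (nat \<Rightarrow> nat \<Rightarrow> real) \<Rightarrow> (nat \<Rightarrow> real) \<Rightarrow> (nat set \<Rightarrow> nat \<Rightarrow> nat \<Rightarrow> real) \<Rightarrow> bool" where
  "rerouting J lam R eta RD \<longleftrightarrow>
     (\<forall>i\<in>{0..J}. \<forall>j\<in>{0..J}. RD {} i j = R i j) \<and>
     (\<forall>D. D \<subseteq> {1..J} \<longrightarrow>
        stochastic_on ({0..J} - D) (RD D) \<and>
        (\<forall>j\<in>{1..J} - D. eta j = lam * RD D 0 j + (\<Sum>i\<in>{1..J} - D. eta i * RD D i j)))"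

definition xi_down :: "nat \<Rightarrow> (nat \<Rightarrow> real) \<Rightarrow> nat set \<Rightarrow> nat \<Rightarrow> real" where
  "xi_down J eta D j = eta j / (\<Sum>k\<in>{0..J} - D. eta k)"

section \<open>The unreliable Jackson network process\<close>

type_synonym state = "nat set \<times> (nat \<Rightarrow> nat)"

definition state_space :: "nat \<Rightarrow> state set" where
  "state_space J = Pow {1..J} \<times> {n. \<forall>j. j \<notin> {1..J} \<longrightarrow> n j = 0}"

definition inc :: "nat \<Rightarrow> (nat \<Rightarrow> nat) \<Rightarrow> nat \<Rightarrow> nat" where
  "inc j n = n(j := n j + 1)"

text \<open>The truncation in \<open>n j - 1\<close> is harmless: \<open>dec j\<close> only occurs with the factor
  \<open>mu j (n j)\<close>, and \<open>mu j 0 = 0\<close>.\<close>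

definition dec :: "nat \<Rightarrow> (nat \<Rightarrow> nat) \<Rightarrow> nat \<Rightarrow> nat" where
  "dec j n = n(j := n j - 1)"

definition gen_Y ::
  "nat \<Rightarrow> (nat set \<Rightarrow> real) \<Rightarrow> (nat set \<Rightarrow> real) \<Rightarrow> (nat set \<Rightarrow> real) \<Rightarrow> nat set \<Rightarrow> real" where
  "gen_Y J A B h D =
     (\<Sum>H | H \<subset> D. B D / B H * (h H - h D)) +
     (\<Sum>I | D \<subset> I \<and> I \<subseteq> {1..J}. A I / A D * (h I - h D))"

definition gen_Z ::
  "nat \<Rightarrow> real \<Rightarrow> (nat \<Rightarrow> nat \<Rightarrow> real) \<Rightarrow> (nat set \<Rightarrow> real) \<Rightarrow> (nat set \<Rightarrow> real) \<Rightarrow>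
   (nat set \<Rightarrow> nat \<Rightarrow> nat \<Rightarrow> real) \<Rightarrow> (state \<Rightarrow> real) \<Rightarrow> state \<Rightarrow> real" where
  "gen_Z J lam mu A B RD f = (\<lambda>(D, n).
     (\<Sum>j\<in>{1..J} - D. lam * RD D 0 j * (f (D, inc j n) - f (D, n))) +
     (\<Sum>j\<in>{1..J} - D. mu j (n j) * RD D j 0 * (f (D, dec j n) - f (D, n))) +
     (\<Sum>j\<in>{1..J} - D. mu j (n j) *
        (\<Sum>i\<in>{1..J} - D. RD D j i * (f (D, inc i (dec j n)) - f (D, n)))) +
     gen_Y J A B (\<lambda>H. f (H, n)) D)"

text \<open>
  The rates of the process are bounded, so its transition function is
  \<open>p\<^sub>t(x, y) = (exp (t Q) 1\<^sub>y)(x)\<close>, given by the convergent exponential series.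
\<close>

definition trans_prob ::
  "((state \<Rightarrow> real) \<Rightarrow> state \<Rightarrow> real) \<Rightarrow> real \<Rightarrow> state \<Rightarrow> state \<Rightarrow> real" where
  "trans_prob Q t x y = (\<Sum>k. t ^ k / fact k * (Q ^^ k) (indicator {y}) x)"

text \<open>
  Ergodicity: from every initial state the law at time \<open>t\<close> converges to one and the same
  probability distribution.  States \<open>(D, n)\<close> with \<open>A D = 0\<close> cannot be reached from
  \<open>({}, n)\<close>, so irreducibility on the whole state space is not demanded.
\<close>

definition ergodic_on :: "state set \<Rightarrow> ((state \<Rightarrow> real) \<Rightarrow> state \<Rightarrow> real) \<Rightarrow> bool" where
  "ergodic_on E Q \<longleftrightarrow>
     (\<exists>\<rho>. (\<forall>y\<in>E. \<rho> y \<ge> 0) \<and> (\<rho> has_sum 1) E \<and>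
        (\<forall>x\<in>E. \<forall>y\<in>E. ((\<lambda>t. trans_prob Q t x y) \<longlongrightarrow> \<rho> y) at_top))"

section \<open>Stationary distribution and spectral gap\<close>

definition norm_const :: "(nat \<Rightarrow> nat \<Rightarrow> real) \<Rightarrow> (nat \<Rightarrow> real) \<Rightarrow> nat \<Rightarrow> real" where
  "norm_const mu eta j = (\<Sum>m. \<Prod>k=1..m. eta j / mu j k)"

definition stat_X ::
  "nat \<Rightarrow> (nat \<Rightarrow> nat \<Rightarrow> real) \<Rightarrow> (nat \<Rightarrow> real) \<Rightarrow> (nat \<Rightarrow> nat) \<Rightarrow> real" where
  "stat_X J mu eta n =
     (\<Prod>j\<in>{1..J}. inverse (norm_const mu eta j) * (\<Prod>k=1..n j. eta j / mu j k))"

text \<open>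
  The case \<open>A D > 0 = B D\<close>, where the quotient should be \<open>\<infinity>\<close>, does not occur for an ergodic
  process: the nodes in \<open>D\<close> could fail but never be repaired, and would keep their queues forever.
\<close>

definition stat_Y :: "nat \<Rightarrow> (nat set \<Rightarrow> real) \<Rightarrow> (nat set \<Rightarrow> real) \<Rightarrow> nat set \<Rightarrow> real" where
  "stat_Y J A B D = inverse (\<Sum>H\<in>Pow {1..J}. A H / B H) * (A D / B D)"

definition stat_Z ::
  "nat \<Rightarrow> (nat \<Rightarrow> nat \<Rightarrow> real) \<Rightarrow> (nat \<Rightarrow> real) \<Rightarrow> (nat set \<Rightarrow> real) \<Rightarrow> (nat set \<Rightarrow> real) \<Rightarrow>
   state \<Rightarrow> real" where
  "stat_Z J mu eta A B = (\<lambda>(D, n). stat_Y J A B D * stat_X J mu eta n)"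

definition inner_on :: "'a set \<Rightarrow> ('a \<Rightarrow> real) \<Rightarrow> ('a \<Rightarrow> real) \<Rightarrow> ('a \<Rightarrow> real) \<Rightarrow> real" where
  "inner_on E \<nu> f g = (\<Sum>\<^sub>\<infinity>x\<in>E. f x * g x * \<nu> x)"

definition L2_on :: "'a set \<Rightarrow> ('a \<Rightarrow> real) \<Rightarrow> ('a \<Rightarrow> real) set" where
  "L2_on E \<nu> = {f. (\<lambda>x. (f x)\<^sup>2 * \<nu> x) summable_on E}"

text \<open>
  For an ergodic \<open>gen_Z\<close> the infimum, taken in \<open>ereal\<close>, is a finite one: the set is nonempty
  and the form is nonnegative.
\<close>

definition spectral_gap ::
  "'a set \<Rightarrow> ('a \<Rightarrow> real) \<Rightarrow> (('a \<Rightarrow> real) \<Rightarrow> 'a \<Rightarrow> real) \<Rightarrow> ereal" where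
  "spectral_gap E \<nu> Q =
     (INF f \<in> {f \<in> L2_on E \<nu>. (\<Sum>\<^sub>\<infinity>x\<in>E. f x * \<nu> x) = 0 \<and> inner_on E \<nu> f f = 1}.
        ereal (inner_on E \<nu> f (\<lambda>x. - Q f x)))"

end

theory Submission
  imports Defs
begin

text \<open>
  The two processes have the same stationary weights, so their gaps are infima over the same set of
  functions, and it suffices to compare the two Dirichlet forms at one fixed square integrable \<open>f\<close>.
  The weights agree because an irreducible matrix has, up to a factor, only one invariant vector:
  both \<open>\<eta>\<close> and \<open>\<eta>'\<close> are the multiple of \<open>\<xi>\<close> with value \<open>\<lambda>\<close> at node \<open>0\<close>
  (\<open>traffic_solution\<close>).

  Failures and repairs are the same in both networks and cancel in \<open>Q' - Q\<close>.  Rows of routing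
  matrices sum to \<open>1\<close>, so the diagonal terms cancel as well.  Treat the outside world as a node \<open>0\<close>
  with \<open>\<mu>\<^sub>0 = \<lambda>\<close> and \<open>e\<^sub>0 = 0\<close>, and put \<open>\<Delta> = R'\<^sup>D - R\<^sup>D\<close>.  Then what is left is
  (\<open>gen_Z_diff\<close>)
  \[ (Q' - Q) f (D, n) = \sum_{i, k \notin D} \mu_i(n_i) \Delta_{ik} f(D, n - e_i + e_k). \]
  The stationary weight satisfies \<open>\<pi>(m + e\<^sub>i) \<mu>\<^sub>i(m\<^sub>i + 1) = \<eta>\<^sub>i \<pi>(m)\<close>, so the substitution
  \<open>n = m + e\<^sub>i\<close> (\<open>has_sum_routed_move\<close>) turns \<open>\<langle>f, (Q' - Q) f\<rangle>\<close> into
  \[ \sum_D \hat\pi(D) \sum_m \pi(m) \sum_{i, k \notin D} \eta_i \Delta_{ik}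
     f(D, m + e_i) f(D, m + e_k). \]
  For each \<open>D\<close> and \<open>m\<close> the inner sum is, up to a positive factor, the quadratic form of \<open>\<Delta>\<close> with
  respect to \<open>\<xi>\<^sup>D\<close> at the function \<open>i \<mapsto> f(D, m + e\<^sub>i)\<close>, which is nonnegative by assumption
  (\<open>routed_form_nonneg\<close>).

  The series for \<open>\<langle>f, (Q' - Q) f\<rangle>\<close> converges because the service rates are bounded.  The two
  Dirichlet forms themselves therefore converge or diverge together, and \<open>infsum\<close> is \<open>0\<close> in the
  divergent case; so the inequality holds in either case (\<open>inner_on_le_of_has_sum_diff\<close>).
\<close>

section \<open>Invariant vectors of an irreducible matrix\<close>

text \<open>Positivity at \<open>i\<close> spreads along every path of positive transitions that starts at \<open>i\<close>.\<close>

lemma positive_vector_of_irreducible: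
  assumes "finite S" and nonneg: "\<And>i j. i \<in> S \<Longrightarrow> j \<in> S \<Longrightarrow> P i j \<ge> 0"
    and irr: "irreducible_on S P"
    and x0: "\<And>j. j \<in> S \<Longrightarrow> x j \<ge> (0::real)"
    and inv: "\<And>j. j \<in> S \<Longrightarrow> x j = (\<Sum>i\<in>S. x i * P i j)"
    and i: "i \<in> S" "x i > 0" and j: "j \<in> S"
  shows "x j > 0"
proof -
  have "(i, j) \<in> {(k, l). k \<in> S \<and> l \<in> S \<and> P k l > 0}\<^sup>*"
    using irr i j by (auto simp: irreducible_on_def)
  then show ?thesis
  proof (induction rule: rtrancl_induct)
    case base
    show ?case by (rule i)
  next
    case (step k l)
    have "0 < x k * P k l" using step by auto
    also have "\<dots> \<le> (\<Sum>i\<in>S. x i * P i l)"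
      by (rule member_le_sum) (use step assms in \<open>auto intro!: mult_nonneg_nonneg\<close>)
    also have "\<dots> = x l" using inv[of l] step by auto
    finally show ?case .
  qed
qed

text \<open>
  The triangle inequality gives \<open>\<bar>d\<bar> \<le> \<bar>d\<bar> P\<close>, and both sides have the same total mass, so \<open>\<bar>d\<bar>\<close>
  is itself invariant.  If it were not zero, it would be positive everywhere, also at \<open>z\<close>.
\<close>

lemma invariant_vector_eq_zero:
  assumes fin: "finite S" and st: "stochastic_on S P" and irr: "irreducible_on S P"
    and inv: "\<And>j. j \<in> S \<Longrightarrow> d j = (\<Sum>i\<in>S. d i * P i j)"
    and z: "z \<in> S" "d z = 0" and j: "j \<in> S"
  shows "d j = (0::real)"
proof (rule ccontr)
  assume "d j \<noteq> 0"
  have P0: "\<And>i j. i \<in> S \<Longrightarrow> j \<in> S \<Longrightarrow> P i j \<ge> 0"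
    and P1: "\<And>i. i \<in> S \<Longrightarrow> (\<Sum>j\<in>S. P i j) = 1"
    using st by (auto simp: stochastic_on_def)
  define y where "y k = (\<Sum>i\<in>S. \<bar>d i\<bar> * P i k)" for k
  have le: "\<bar>d k\<bar> \<le> y k" if "k \<in> S" for k
  proof -
    have "\<bar>d k\<bar> = \<bar>\<Sum>i\<in>S. d i * P i k\<bar>" using inv[OF that] by simp
    also have "\<dots> \<le> (\<Sum>i\<in>S. \<bar>d i * P i k\<bar>)" by (rule sum_abs)
    also have "\<dots> = y k"
      unfolding y_def by (rule sum.cong) (use P0 that in \<open>auto simp: abs_mult\<close>)
    finally show ?thesis .
  qed
  \<comment> \<open>The termwise inequality has equal sums on both sides, hence is an equality.\<close>
  have "(\<Sum>k\<in>S. y k) = (\<Sum>i\<in>S. \<Sum>k\<in>S. \<bar>d i\<bar> * P i k)"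
    unfolding y_def by (rule sum.swap)
  also have "\<dots> = (\<Sum>i\<in>S. \<bar>d i\<bar>)"
    by (rule sum.cong) (simp_all add: sum_distrib_left[symmetric] P1)
  finally have "(\<Sum>k\<in>S. y k - \<bar>d k\<bar>) = 0" by (simp add: sum_subtractf)
  then have eq: "\<bar>d k\<bar> = y k" if "k \<in> S" for k
    using sum_nonneg_eq_0_iff[OF fin, of "\<lambda>k. y k - \<bar>d k\<bar>"] le that by auto
  have "\<bar>d z\<bar> > 0"
  proof (rule positive_vector_of_irreducible[OF fin P0 irr, where i = j])
    show "\<And>k. k \<in> S \<Longrightarrow> \<bar>d k\<bar> = (\<Sum>i\<in>S. \<bar>d i\<bar> * P i k)"
      using eq by (simp add: y_def)
  qed (use \<open>d j \<noteq> 0\<close> z j in auto)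
  with z show False by simp
qed

text \<open>
  The traffic equations are those of \<open>\<eta> = \<eta> R\<close> at the nodes \<open>1, \<dots>, J\<close>.  The missing one at node
  \<open>0\<close> follows by summation, since \<open>\<eta>\<close> and \<open>\<eta> R\<close> have the same total mass.
\<close>

lemma traffic_solution_invariant:
  assumes st: "stochastic_on {0..J} R" and e0: "eta 0 = lam"
    and tr: "\<And>j. j \<in> {1..J} \<Longrightarrow> eta j = lam * R 0 j + (\<Sum>i\<in>{1..J}. eta i * R i j)"
    and j: "j \<in> {0..J}"
  shows "eta j = (\<Sum>i\<in>{0..J}. eta i * R i j)"
proof -
  have split: "(\<Sum>i\<in>{0..J}. g i) = g 0 + (\<Sum>i\<in>{1..J}. g i)" for g :: "nat \<Rightarrow> real"
    by (simp add: sum.atLeast_Suc_atMost)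
  have pos: "eta k = (\<Sum>i\<in>{0..J}. eta i * R i k)" if "k \<in> {1..J}" for k
    using tr[OF that] e0 by (simp add: split)
  have "(\<Sum>k\<in>{0..J}. \<Sum>i\<in>{0..J}. eta i * R i k) = (\<Sum>i\<in>{0..J}. \<Sum>k\<in>{0..J}. eta i * R i k)"
    by (rule sum.swap)
  also have "\<dots> = (\<Sum>i\<in>{0..J}. eta i)"
    by (rule sum.cong) (use st in \<open>auto simp: sum_distrib_left[symmetric] stochastic_on_def\<close>)
  finally have "eta 0 + (\<Sum>k\<in>{1..J}. eta k)
      = (\<Sum>i\<in>{0..J}. eta i * R i 0) + (\<Sum>k\<in>{1..J}. \<Sum>i\<in>{0..J}. eta i * R i k)"
    by (simp only: split[of eta] split[of "\<lambda>k. \<Sum>i\<in>{0..J}. eta i * R i k"])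
  moreover have "(\<Sum>k\<in>{1..J}. \<Sum>i\<in>{0..J}. eta i * R i k) = (\<Sum>k\<in>{1..J}. eta k)"
    using pos by (intro sum.cong) auto
  ultimately have "eta 0 = (\<Sum>i\<in>{0..J}. eta i * R i 0)" by linarith
  with pos j show ?thesis by (cases "j = 0") auto
qed

lemma jackson_networkD:
  assumes "jackson_network J lam mu R eta"
  shows "lam > 0" "stochastic_on {0..J} R" "irreducible_on {0..J} R" "eta 0 = lam"
    and "bdd_above (\<Union>j\<in>{1..J}. range (mu j))"
    and "\<And>j. j \<in> {1..J} \<Longrightarrow> mu j 0 = 0"
    and "\<And>j k. j \<in> {1..J} \<Longrightarrow> k \<ge> 1 \<Longrightarrow> mu j k > 0"
    and "\<And>j. j \<in> {1..J} \<Longrightarrow> eta j = lam * R 0 j + (\<Sum>i\<in>{1..J}. eta i * R i j)"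
    and "\<And>j. j \<in> {1..J} \<Longrightarrow> summable (\<lambda>m. \<Prod>k=1..m. eta j / mu j k)"
  using assms unfolding jackson_network_def
  by - (blast | (elim conjE, assumption))+

lemma traffic_solution:
  assumes net: "jackson_network J lam mu R eta" and xi: "invariant_prob_on {0..J} R xi"
    and j: "j \<in> {0..J}"
  shows "xi j > 0" and "eta j = lam / xi 0 * xi j"
proof -
  note st = jackson_networkD(2)[OF net] and irr = jackson_networkD(3)[OF net]
    and e0 = jackson_networkD(4)[OF net] and tr = jackson_networkD(8)[OF net]
  have R0: "\<And>i j. i \<in> {0..J} \<Longrightarrow> j \<in> {0..J} \<Longrightarrow> R i j \<ge> 0"
    using st by (auto simp: stochastic_on_def)
  have x0: "\<And>j. j \<in> {0..J} \<Longrightarrow> xi j \<ge> 0" and x1: "(\<Sum>j\<in>{0..J}. xi j) = 1"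
    and xinv: "\<And>j. j \<in> {0..J} \<Longrightarrow> xi j = (\<Sum>i\<in>{0..J}. xi i * R i j)"
    using xi unfolding invariant_prob_on_def by blast+
  obtain i where i: "i \<in> {0..J}" "xi i > 0"
  proof (rule ccontr)
    assume "\<not> thesis"
    then have "\<forall>i\<in>{0..J}. xi i = 0" using x0 that by fastforce
    then show False using x1 by simp
  qed
  have pos: "xi k > 0" if "k \<in> {0..J}" for k
    by (rule positive_vector_of_irreducible[OF _ R0 irr x0 xinv i that]) auto
  then show "xi j > 0" using j .
  have "eta j - lam / xi 0 * xi j = 0"
  proof (rule invariant_vector_eq_zero[OF _ st irr, where z = 0])
    fix k assume k: "k \<in> {0..J}"
    have "eta k - lam / xi 0 * xi k
        = (\<Sum>i\<in>{0..J}. eta i * R i k) - lam / xi 0 * (\<Sum>i\<in>{0..J}. xi i * R i k)"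
      using traffic_solution_invariant[OF st e0 tr k] xinv[OF k] by simp
    also have "\<dots> = (\<Sum>i\<in>{0..J}. (eta i - lam / xi 0 * xi i) * R i k)"
      by (simp add: sum_distrib_left sum_subtractf left_diff_distrib mult.assoc)
    finally show "eta k - lam / xi 0 * xi k = (\<Sum>i\<in>{0..J}. (eta i - lam / xi 0 * xi i) * R i k)" .
  qed (use pos[of 0] e0 j in auto)
  then show "eta j = lam / xi 0 * xi j" by simp
qed

section \<open>Customer moves as routed departures and arrivals\<close>

definition queues :: "nat \<Rightarrow> (nat \<Rightarrow> nat) set" where
  "queues J = {n. \<forall>j. j \<notin> {1..J} \<longrightarrow> n j = 0}"

text \<open>
  The outside world is treated as one more node \<open>0\<close> with service rate \<open>\<lambda>\<close>, whose queue is not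
  recorded: in the usual notation \<open>e\<^sub>0 = 0\<close> and \<open>\<mu>\<^sub>0 = \<lambda>\<close>.
\<close>

definition arrive :: "nat \<Rightarrow> (nat \<Rightarrow> nat) \<Rightarrow> nat \<Rightarrow> nat" where
  "arrive k n = (if k = 0 then n else inc k n)"

definition depart :: "nat \<Rightarrow> (nat \<Rightarrow> nat) \<Rightarrow> nat \<Rightarrow> nat" where
  "depart i n = (if i = 0 then n else dec i n)"

definition service_rate ::
  "real \<Rightarrow> (nat \<Rightarrow> nat \<Rightarrow> real) \<Rightarrow> nat \<Rightarrow> (nat \<Rightarrow> nat) \<Rightarrow> real" where
  "service_rate lam mu i n = (if i = 0 then lam else mu i (n i))"

lemma depart_arrive: "depart i (arrive i n) = n"
  by (auto simp: depart_def arrive_def dec_def inc_def)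

text \<open>
  External arrivals, departures to the outside and internal transfers are all of one kind: node \<open>i\<close>
  releases a customer at its service rate, who is routed to \<open>k\<close>.  The additional case \<open>i = k = 0\<close>
  changes nothing and contributes \<open>0\<close>.
\<close>

lemma gen_Z_as_routed_moves:
  assumes D: "D \<subseteq> {1..J}"
  shows "gen_Z J lam mu A B RD f (D, n) =
    (\<Sum>i\<in>{0..J} - D. service_rate lam mu i n *
        (\<Sum>k\<in>{0..J} - D. RD D i k * (f (D, arrive k (depart i n)) - f (D, n))))
    + gen_Y J A B (\<lambda>H. f (H, n)) D"
proof -
  have S: "{0..J} - D = insert 0 ({1..J} - D)" using D by auto
  have split: "(\<Sum>i\<in>{0..J} - D. g i) = g 0 + (\<Sum>i\<in>{1..J} - D. g i)" for g :: "nat \<Rightarrow> real"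
    unfolding S by (subst sum.insert) auto
  have "(\<Sum>i\<in>{1..J} - D. service_rate lam mu i n *
        (\<Sum>k\<in>{0..J} - D. RD D i k * (f (D, arrive k (depart i n)) - f (D, n))))
      = (\<Sum>i\<in>{1..J} - D. mu i (n i) * RD D i 0 * (f (D, dec i n) - f (D, n)) +
          mu i (n i) * (\<Sum>k\<in>{1..J} - D. RD D i k * (f (D, inc k (dec i n)) - f (D, n))))"
    by (intro sum.cong refl)
       (auto simp: split service_rate_def arrive_def depart_def distrib_left mult.assoc)
  moreover have "service_rate lam mu 0 n *
        (\<Sum>k\<in>{0..J} - D. RD D 0 k * (f (D, arrive k (depart 0 n)) - f (D, n)))
      = (\<Sum>k\<in>{1..J} - D. lam * RD D 0 k * (f (D, inc k n) - f (D, n)))"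
    by (simp add: split service_rate_def arrive_def depart_def sum_distrib_left mult.assoc)
  ultimately show ?thesis
    by (simp add: gen_Z_def split[of "\<lambda>i. service_rate lam mu i n * _ i"] sum.distrib)
qed

lemma gen_Z_diff:
  assumes D: "D \<subseteq> {1..J}"
    and st: "stochastic_on ({0..J} - D) (RD D)" "stochastic_on ({0..J} - D) (RD' D)"
  shows "gen_Z J lam mu A B RD' f (D, n) - gen_Z J lam mu A B RD f (D, n) =
    (\<Sum>i\<in>{0..J} - D. \<Sum>k\<in>{0..J} - D.
        service_rate lam mu i n * (RD' D i k - RD D i k) * f (D, arrive k (depart i n)))"
proof -
  have *: "(\<Sum>k\<in>{0..J} - D. P i k * (f (D, arrive k m) - f (D, n)))
      = (\<Sum>k\<in>{0..J} - D. P i k * f (D, arrive k m)) - f (D, n)"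
    if "i \<in> {0..J} - D" "stochastic_on ({0..J} - D) P" for P i m
    using that by (simp add: right_diff_distrib sum_subtractf sum_distrib_right[symmetric]
        stochastic_on_def)
  have "service_rate lam mu i n *
        (\<Sum>k\<in>{0..J} - D. RD' D i k * (f (D, arrive k (depart i n)) - f (D, n)))
      - service_rate lam mu i n *
        (\<Sum>k\<in>{0..J} - D. RD D i k * (f (D, arrive k (depart i n)) - f (D, n)))
      = (\<Sum>k\<in>{0..J} - D.
        service_rate lam mu i n * (RD' D i k - RD D i k) * f (D, arrive k (depart i n)))"
    if "i \<in> {0..J} - D" for i
    unfolding *[OF that st(1)] *[OF that st(2)]
    by (simp only: mult.assoc left_diff_distrib right_diff_distrib sum_subtractf
        sum_distrib_left[symmetric])
  then show ?thesis
    unfolding gen_Z_as_routed_moves[OF D] add_diff_cancel_right sum_subtractf[symmetric]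
    by (rule sum.cong[OF refl])
qed

section \<open>The product form weight and the change of variables\<close>

lemma stat_X_nonneg:
  assumes net: "jackson_network J lam mu R eta" and eta: "\<And>j. j \<in> {1..J} \<Longrightarrow> eta j > 0"
  shows "stat_X J mu eta n \<ge> 0"
proof -
  have p: "(\<Prod>k=1..m. eta j / mu j k) \<ge> 0" if "j \<in> {1..J}" for j m
    using jackson_networkD(7)[OF net that] eta[OF that]
    by (intro prod_nonneg) (auto intro!: divide_nonneg_pos less_imp_le)
  have "norm_const mu eta j \<ge> 0" if "j \<in> {1..J}" for j
    unfolding norm_const_def
    by (rule suminf_nonneg) (use jackson_networkD(9)[OF net that] p[OF that] in auto)
  with p show ?thesis unfolding stat_X_def by (intro prod_nonneg) simp
qed

text \<open>
  With \<open>m + e\<^sub>i\<close> in place of \<open>m\<close>, only the \<open>i\<close>-th factor of the product changes: it gains the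
  quotient \<open>\<eta>\<^sub>i / \<mu>\<^sub>i(m\<^sub>i + 1)\<close>.
\<close>

lemma stat_X_balance:
  assumes net: "jackson_network J lam mu R eta" and i: "i \<in> {0..J}"
  shows "stat_X J mu eta (arrive i m) * service_rate lam mu i (arrive i m)
    = eta i * stat_X J mu eta m"
proof (cases "i = 0")
  case True
  with jackson_networkD(4)[OF net] show ?thesis by (simp add: arrive_def service_rate_def)
next
  case False
  then have i1: "i \<in> {1..J}" using i by auto
  have pos: "mu i (Suc (m i)) > 0" using jackson_networkD(7)[OF net i1] by simp
  define g where "g n j = inverse (norm_const mu eta j) * (\<Prod>k=1..n j. eta j / mu j k)"
    for n :: "nat \<Rightarrow> nat" and j
  have X: "stat_X J mu eta n = g n i * (\<Prod>j\<in>{1..J} - {i}. g n j)" for n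
    unfolding stat_X_def g_def using i1 by (intro prod.remove) auto
  have "(\<Prod>j\<in>{1..J} - {i}. g (inc i m) j) = (\<Prod>j\<in>{1..J} - {i}. g m j)"
    by (intro prod.cong) (auto simp: g_def inc_def)
  moreover have "g (inc i m) i * mu i (Suc (m i)) = eta i * g m i"
    using pos by (simp add: g_def inc_def)
  ultimately show ?thesis
    using False by (simp add: X arrive_def service_rate_def inc_def algebra_simps)
qed

text \<open>
  The substitution \<open>n = m + e\<^sub>i\<close>.  It misses only the \<open>n\<close> with \<open>n\<^sub>i = 0\<close>, for which the service
  rate vanishes.  The two arguments of \<open>g\<close> are the states before the release of a customer and
  with this customer removed.
\<close>

lemma has_sum_routed_move:
  assumes mu0: "\<And>j. j \<in> {1..J} \<Longrightarrow> mu j 0 = 0"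
    and bal: "\<And>m. w (arrive i m) * service_rate lam mu i (arrive i m) = eta i * w m"
    and i: "i \<in> {0..J}"
  shows "((\<lambda>n. w n * service_rate lam mu i n * g n (depart i n)) has_sum s) (queues J)
    \<longleftrightarrow> ((\<lambda>m. eta i * w m * g (arrive i m) m) has_sum (s::real)) (queues J)"
proof -
  have inj: "inj_on (arrive i) (queues J)"
    by (rule inj_on_inverseI[where g = "depart i"]) (rule depart_arrive)
  have sub: "arrive i ` queues J \<subseteq> queues J"
    using i by (auto simp: queues_def arrive_def inc_def)
  have zero: "service_rate lam mu i n = 0" if "n \<in> queues J - arrive i ` queues J" for n
  proof -
    have "i \<noteq> 0" using that by (intro notI) (simp add: arrive_def)
    moreover have "n i = 0"
    proof (rule ccontr)
      assume "n i \<noteq> 0"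
      then have "arrive i (depart i n) = n" using \<open>i \<noteq> 0\<close>
        by (auto simp: arrive_def depart_def inc_def dec_def)
      moreover have "depart i n \<in> queues J"
        using that by (auto simp: queues_def depart_def dec_def)
      ultimately show False using that by (metis DiffD2 imageI)
    qed
    ultimately show ?thesis using mu0 i by (simp add: service_rate_def)
  qed
  have "((\<lambda>n. w n * service_rate lam mu i n * g n (depart i n)) has_sum s) (queues J)
    \<longleftrightarrow> ((\<lambda>n. w n * service_rate lam mu i n * g n (depart i n)) has_sum s) (arrive i ` queues J)"
    by (rule has_sum_cong_neutral) (use zero sub in auto)
  also have "\<dots> \<longleftrightarrow> ((\<lambda>m. eta i * w m * g (arrive i m) m) has_sum s) (queues J)"
    unfolding has_sum_reindex[OF inj] by (simp add: o_def bal depart_arrive)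
  finally show ?thesis .
qed

lemma has_sum_sum:
  fixes f :: "'b \<Rightarrow> 'a \<Rightarrow> 'c::topological_comm_monoid_add"
  assumes "finite I" "\<And>i. i \<in> I \<Longrightarrow> (f i has_sum s i) A"
  shows "((\<lambda>x. \<Sum>i\<in>I. f i x) has_sum (\<Sum>i\<in>I. s i)) A"
  using assms by (induction I rule: finite_induct) (auto intro!: has_sum_add)

text \<open>
  By \<open>2 \<bar>a b\<bar> \<le> a\<^sup>2 + b\<^sup>2\<close> it suffices to sum \<open>w(m) F(m + e\<^sub>i)\<^sup>2\<close>.  The substitution leads
  back from this series, up to the factor \<open>\<eta>\<^sub>i\<close>, to that of \<open>w(n) \<mu>\<^sub>i(n\<^sub>i) F(n)\<^sup>2\<close>, where the rate is
  at most \<open>M\<close>.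
\<close>

lemma summable_shifted_products:
  assumes mu0: "\<And>j. j \<in> {1..J} \<Longrightarrow> mu j 0 = 0"
    and munn: "\<And>j k. j \<in> {1..J} \<Longrightarrow> mu j k \<ge> 0"
    and bdd: "\<And>j k. j \<in> {1..J} \<Longrightarrow> mu j k \<le> M" and lam: "0 \<le> lam" "lam \<le> M"
    and w0: "\<And>n. w n \<ge> 0"
    and bal: "\<And>i m. i \<in> {0..J} \<Longrightarrow>
        w (arrive i m) * service_rate lam mu i (arrive i m) = eta i * w m"
    and eta: "\<And>i. i \<in> {0..J} \<Longrightarrow> eta i > 0"
    and L2: "(\<lambda>n. (F n)\<^sup>2 * w n) summable_on queues J"
    and i: "i \<in> {0..J}" and k: "k \<in> {0..J}"
  shows "(\<lambda>m. w m * (F (arrive i m) * F (arrive k m) :: real)) summable_on queues J"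
proof -
  have rate: "0 \<le> service_rate lam mu i n" "service_rate lam mu i n \<le> M" if "i \<in> {0..J}" for i n
    using that munn bdd lam by (auto simp: service_rate_def)
  have sq: "(\<lambda>m. w m * (F (arrive i m))\<^sup>2) summable_on queues J" if i: "i \<in> {0..J}" for i
  proof -
    have "(\<lambda>n. M * ((F n)\<^sup>2 * w n)) summable_on queues J"
      by (rule summable_on_cmult_right[OF L2])
    then have "(\<lambda>n. service_rate lam mu i n * ((F n)\<^sup>2 * w n)) summable_on queues J"
      by (rule summable_on_comparison_test)
        (use rate[OF i] w0 in \<open>auto intro!: mult_right_mono mult_nonneg_nonneg\<close>)
    then have "(\<lambda>n. w n * service_rate lam mu i n * (F n)\<^sup>2) summable_on queues J"
      by (simp add: mult_ac)
    then have "(\<lambda>m. eta i * w m * (F (arrive i m))\<^sup>2) summable_on queues J"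
      using has_sum_routed_move[where w = w and g = "\<lambda>n _. (F n)\<^sup>2" and eta = eta, OF mu0 bal[OF i] i]
      by (auto simp: summable_on_def)
    then have "(\<lambda>m. inverse (eta i) * (eta i * w m * (F (arrive i m))\<^sup>2)) summable_on queues J"
      by (rule summable_on_cmult_right)
    then show ?thesis using eta[OF i] by (simp add: mult.assoc[symmetric])
  qed
  have "(\<lambda>m. w m * (F (arrive i m))\<^sup>2 + w m * (F (arrive k m))\<^sup>2) summable_on queues J"
    by (intro summable_on_add sq i k)
  then have "(\<lambda>m. norm (w m * (F (arrive i m) * F (arrive k m)))) summable_on queues J"
  proof (rule summable_on_comparison_test)
    fix m
    have ab: "\<bar>a * b\<bar> \<le> a\<^sup>2 + b\<^sup>2" for a b :: real
    proof -
      have "2 * (\<bar>a\<bar> * \<bar>b\<bar>) \<le> a\<^sup>2 + b\<^sup>2" using sum_squares_bound[of "\<bar>a\<bar>" "\<bar>b\<bar>"] by simp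
      moreover have "0 \<le> \<bar>a\<bar> * \<bar>b\<bar>" by simp
      ultimately show ?thesis unfolding abs_mult by linarith
    qed
    have "norm (w m * (F (arrive i m) * F (arrive k m)))
        = w m * \<bar>F (arrive i m) * F (arrive k m)\<bar>"
      using w0[of m] by (simp add: abs_mult)
    also have "\<dots> \<le> w m * ((F (arrive i m))\<^sup>2 + (F (arrive k m))\<^sup>2)"
      by (intro mult_left_mono ab w0)
    finally show "norm (w m * (F (arrive i m) * F (arrive k m)))
        \<le> w m * (F (arrive i m))\<^sup>2 + w m * (F (arrive k m))\<^sup>2"
      by (simp add: distrib_left)
  qed simp
  then show ?thesis by (rule abs_summable_summable)
qed

section \<open>The quadratic form of the difference of the generators\<close>

text \<open>
  This is the contribution of one set of broken down nodes, with \<open>S\<close> the set of the remaining nodes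
  and the outside, and \<open>F = f(D, \<cdot>)\<close>.  After the substitution in each of the finitely many terms, the
  weight and the point \<open>m\<close> no longer depend on \<open>i\<close>, so \<open>\<Delta>\<close> acts as a quadratic form for each \<open>m\<close>.
\<close>

lemma routed_form_nonneg:
  assumes mu0: "\<And>j. j \<in> {1..J} \<Longrightarrow> mu j 0 = 0"
    and munn: "\<And>j k. j \<in> {1..J} \<Longrightarrow> mu j k \<ge> 0"
    and bdd: "\<And>j k. j \<in> {1..J} \<Longrightarrow> mu j k \<le> M" and lam: "0 \<le> lam" "lam \<le> M"
    and w0: "\<And>n. w n \<ge> 0"
    and bal: "\<And>i m. i \<in> {0..J} \<Longrightarrow>
        w (arrive i m) * service_rate lam mu i (arrive i m) = eta i * w m"
    and eta: "\<And>i. i \<in> {0..J} \<Longrightarrow> eta i > 0"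
    and L2: "(\<lambda>n. (F n)\<^sup>2 * w n) summable_on queues J"
    and S: "S \<subseteq> {0..J}"
    and psd: "\<And>h :: nat \<Rightarrow> real. (\<Sum>i\<in>S. \<Sum>k\<in>S. eta i * \<Delta> i k * (h i * h k)) \<ge> 0"
  obtains s where "s \<ge> (0::real)"
    and "((\<lambda>n. F n * (\<Sum>i\<in>S. \<Sum>k\<in>S. service_rate lam mu i n * \<Delta> i k * F (arrive k (depart i n))) * w n)
          has_sum s) (queues J)"
proof -
  let ?g = "\<lambda>i k m. eta i * w m * (\<Delta> i k * (F (arrive i m) * F (arrive k m)))"
  have fin: "finite S" using S finite_subset by blast
  have g: "(?g i k has_sum infsum (?g i k) (queues J)) (queues J)" if "i \<in> S" "k \<in> S" for i k
  proof -
    have "(\<lambda>m. eta i * \<Delta> i k * (w m * (F (arrive i m) * F (arrive k m)))) summable_on queues J"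
      using that S
      by (intro summable_on_cmult_right
          summable_shifted_products[OF mu0 munn bdd lam w0 bal eta L2]) auto
    then show ?thesis by (intro has_sum_infsum) (simp add: mult_ac)
  qed
  let ?s = "\<Sum>i\<in>S. \<Sum>k\<in>S. infsum (?g i k) (queues J)"
  have "((\<lambda>m. \<Sum>i\<in>S. \<Sum>k\<in>S. ?g i k m) has_sum ?s) (queues J)"
    by (intro has_sum_sum fin g)
  moreover have "(\<Sum>i\<in>S. \<Sum>k\<in>S. ?g i k m) \<ge> 0" for m
  proof -
    have "(\<Sum>i\<in>S. \<Sum>k\<in>S. ?g i k m)
        = w m * (\<Sum>i\<in>S. \<Sum>k\<in>S. eta i * \<Delta> i k * (F (arrive i m) * F (arrive k m)))"
      by (simp add: sum_distrib_left mult_ac)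
    then show ?thesis using w0[of m] psd[of "\<lambda>i. F (arrive i m)"] by simp
  qed
  ultimately have "?s \<ge> 0" by (rule has_sum_nonneg)
  moreover have "((\<lambda>n. \<Sum>i\<in>S. \<Sum>k\<in>S. w n * service_rate lam mu i n *
      (\<Delta> i k * (F n * F (arrive k (depart i n))))) has_sum ?s) (queues J)"
  proof (intro has_sum_sum fin)
    fix i k assume ik: "i \<in> S" "k \<in> S"
    have i: "i \<in> {0..J}" using ik S by auto
    show "((\<lambda>n. w n * service_rate lam mu i n * (\<Delta> i k * (F n * F (arrive k (depart i n)))))
        has_sum infsum (?g i k) (queues J)) (queues J)"
      using has_sum_routed_move[where w = w and eta = eta
          and g = "\<lambda>n m. \<Delta> i k * (F n * F (arrive k m))", OF mu0 bal[OF i] i] g[OF ik]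
      by blast
  qed
  then have "((\<lambda>n. F n * (\<Sum>i\<in>S. \<Sum>k\<in>S. service_rate lam mu i n * \<Delta> i k *
      F (arrive k (depart i n))) * w n) has_sum ?s) (queues J)"
    by (simp add: sum_distrib_left sum_distrib_right mult_ac)
  ultimately show thesis by (rule that)
qed

text \<open>
  A convergent difference makes the two series converge or diverge together; in the divergent case
  both values are \<open>0\<close>.
\<close>

lemma inner_on_le_of_has_sum_diff:
  assumes "((\<lambda>x. f x * (g' x - g x) * \<nu> x) has_sum s) E" and "s \<ge> 0"
  shows "inner_on E \<nu> f (\<lambda>x. - g' x) \<le> inner_on E \<nu> f (\<lambda>x. - g x)"
proof (cases "(\<lambda>x. f x * - g x * \<nu> x) summable_on E")
  case True
  have "((\<lambda>x. f x * - g x * \<nu> x + - (f x * (g' x - g x) * \<nu> x))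
      has_sum (inner_on E \<nu> f (\<lambda>x. - g x) + - s)) E"
    unfolding inner_on_def by (intro has_sum_add has_sum_infsum True has_sum_uminusI assms)
  then have "((\<lambda>x. f x * - g' x * \<nu> x) has_sum (inner_on E \<nu> f (\<lambda>x. - g x) + - s)) E"
    by (simp add: algebra_simps)
  then have "inner_on E \<nu> f (\<lambda>x. - g' x) = inner_on E \<nu> f (\<lambda>x. - g x) + - s"
    unfolding inner_on_def by (rule infsumI)
  then show ?thesis using assms by simp
next
  case False
  have "\<not> (\<lambda>x. f x * - g' x * \<nu> x) summable_on E"
  proof
    assume "(\<lambda>x. f x * - g' x * \<nu> x) summable_on E"
    then have "(\<lambda>x. f x * - g' x * \<nu> x + f x * (g' x - g x) * \<nu> x) summable_on E"
      using assms by (intro summable_on_add) (auto simp: summable_on_def)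
    then show False using False by (simp add: algebra_simps)
  qed
  with False show ?thesis by (simp add: inner_on_def infsum_not_exists)
qed

lemma spectral_gap_mono:
  assumes "\<And>f. f \<in> L2_on E \<nu> \<Longrightarrow>
    inner_on E \<nu> f (\<lambda>x. - Q' f x) \<le> inner_on E \<nu> f (\<lambda>x. - Q f x)"
  shows "spectral_gap E \<nu> Q' \<le> spectral_gap E \<nu> Q"
  unfolding spectral_gap_def by (rule INF_mono) (use assms in auto)

lemma pd_le_bilinear:
  assumes pd: "pd_le S (\<lambda>j. eta j / c) P P'" and c: "c > 0"
  shows "(\<Sum>i\<in>S. \<Sum>k\<in>S. eta i * (P' i k - P i k) * (h i * h k)) \<ge> 0"
proof -
  have "0 \<le> c * (\<Sum>i\<in>S. eta i / c * h i * (\<Sum>k\<in>S. (P' i k - P i k) * h k))"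
    using pd c by (auto simp: pd_le_def)
  also have "\<dots> = (\<Sum>i\<in>S. \<Sum>k\<in>S. eta i * (P' i k - P i k) * (h i * h k))"
    using c by (simp add: sum_distrib_left mult_ac)
  finally show ?thesis .
qed

theorem proposition4p3:
  fixes J :: nat and lam :: real
    and mu :: "nat \<Rightarrow> nat \<Rightarrow> real"
    and A B :: "nat set \<Rightarrow> real"
    and R R' :: "nat \<Rightarrow> nat \<Rightarrow> real"
    and RD RD' :: "nat set \<Rightarrow> nat \<Rightarrow> nat \<Rightarrow> real"
    and eta eta' xi :: "nat \<Rightarrow> real"
  assumes "jackson_network J lam mu R eta"
    and "jackson_network J lam mu R' eta'"
    and "failure_repair J A B"
    and "invariant_prob_on {0..J} R xi"
    and "invariant_prob_on {0..J} R' xi"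
    and "rerouting J lam R eta RD"
    and "rerouting J lam R' eta' RD'"
    and "ergodic_on (state_space J) (gen_Z J lam mu A B RD)"
    and "ergodic_on (state_space J) (gen_Z J lam mu A B RD')"
    and "\<And>D. D \<subseteq> {1..J} \<Longrightarrow> pd_le ({0..J} - D) (xi_down J eta D) (RD D) (RD' D)"
  shows "spectral_gap (state_space J) (stat_Z J mu eta' A B) (gen_Z J lam mu A B RD')
       \<le> spectral_gap (state_space J) (stat_Z J mu eta A B) (gen_Z J lam mu A B RD)"
proof -
  note net = assms(1) and net' = assms(2) and pd = assms(10)
  note lam = jackson_networkD(1)[OF net] and bdd = jackson_networkD(5)[OF net]
    and mu0 = jackson_networkD(6)[OF net]
  have munn: "mu j k \<ge> 0" if "j \<in> {1..J}" for j k
    using mu0[OF that] jackson_networkD(7)[OF net that, of k] by (cases "k = 0") auto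
  obtain M0 where M0: "\<And>j k. j \<in> {1..J} \<Longrightarrow> mu j k \<le> M0"
    using bdd unfolding bdd_above_def by blast
  \<comment> \<open>One bound for all service rates, including the rate \<open>\<lambda>\<close> of node \<open>0\<close>.\<close>
  define M where "M = max lam M0"
  have M: "mu j k \<le> M" if "j \<in> {1..J}" for j k
    using M0[OF that, of k] by (simp add: M_def)
  have "eta j > 0" if "j \<in> {0..J}" for j
    using traffic_solution[OF net assms(4)] that lam by simp
  note eta_pos = this
  have eta_eq: "eta' j = eta j" if "j \<in> {0..J}" for j
    using traffic_solution(2)[OF net assms(4) that] traffic_solution(2)[OF net' assms(5) that]
    by simp
  have stat_eq: "stat_Z J mu eta' A B = stat_Z J mu eta A B"
    unfolding stat_Z_def stat_X_def norm_const_def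
    by (intro ext) (auto simp: eta_eq intro!: prod.cong)
  have Y0: "stat_Y J A B D \<ge> 0" if "D \<subseteq> {1..J}" for D
    unfolding stat_Y_def using assms(3) that
    by (intro mult_nonneg_nonneg) (auto simp: failure_repair_def intro!: sum_nonneg)
  have space: "state_space J = (\<Union>D\<in>Pow {1..J}. Pair D ` queues J)"
    by (auto simp: state_space_def queues_def)
  show ?thesis
    unfolding stat_eq
  proof (rule spectral_gap_mono)
    fix f
    assume f: "f \<in> L2_on (state_space J) (stat_Z J mu eta A B)"
    let ?d = "\<lambda>x. f x * (gen_Z J lam mu A B RD' f x - gen_Z J lam mu A B RD f x)
        * stat_Z J mu eta A B x"
    have nonneg_part: "\<exists>s\<ge>0. (?d has_sum s) (Pair D ` queues J)" if D: "D \<in> Pow {1..J}" for D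
    proof -
      let ?w = "\<lambda>n. stat_Y J A B D * stat_X J mu eta n"
      have inj: "inj_on (Pair D) (queues J)" by (auto simp: inj_on_def)
      have S: "{0..J} - D \<subseteq> {0..J}" by auto
      have w0: "?w n \<ge> 0" for n
        using Y0[of D] D stat_X_nonneg[OF net] eta_pos by simp
      have bal: "?w (arrive i m) * service_rate lam mu i (arrive i m) = eta i * ?w m"
        if "i \<in> {0..J}" for i m
        using stat_X_balance[OF net that, of m] by (simp add: algebra_simps)
      have "(\<lambda>x. (f x)\<^sup>2 * stat_Z J mu eta A B x) summable_on Pair D ` queues J"
        using f space D by (auto simp: L2_on_def intro: summable_on_subset_banach)
      then have L2: "(\<lambda>n. (f (D, n))\<^sup>2 * ?w n) summable_on queues J"
        unfolding summable_on_reindex[OF inj] by (simp add: o_def stat_Z_def)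
      have "0 < (\<Sum>k\<in>{0..J} - D. eta k)"
        using D eta_pos by (intro sum_pos2[where i = 0]) (auto intro: less_imp_le)
      then have psd: "0 \<le> (\<Sum>i\<in>{0..J} - D. \<Sum>k\<in>{0..J} - D.
          eta i * (RD' D i k - RD D i k) * (h i * h k))" for h
        using pd[of D] D by (intro pd_le_bilinear) (auto simp: xi_down_def[abs_def])
      have st: "stochastic_on ({0..J} - D) (RD D)" "stochastic_on ({0..J} - D) (RD' D)"
        using assms(6,7) D by (auto simp: rerouting_def)
      obtain s where s: "s \<ge> 0" "((\<lambda>n. f (D, n) * (\<Sum>i\<in>{0..J} - D. \<Sum>k\<in>{0..J} - D.
          service_rate lam mu i n * (RD' D i k - RD D i k) * f (D, arrive k (depart i n))) * ?w n)
          has_sum s) (queues J)"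
        by (rule routed_form_nonneg[where w = ?w and F = "\<lambda>n. f (D, n)" and eta = eta
              and \<Delta> = "\<lambda>i k. RD' D i k - RD D i k" and S = "{0..J} - D",
              OF mu0 munn M less_imp_le[OF lam] _ w0 bal eta_pos L2 S psd])
          (auto simp: M_def)
      then have "(?d has_sum s) (Pair D ` queues J)"
        using gen_Z_diff[where RD = RD and RD' = RD', OF _ st] D
        unfolding has_sum_reindex[OF inj] by (simp add: o_def stat_Z_def)
      with s show ?thesis by blast
    qed
    have "\<forall>D\<in>Pow {1..J}. \<exists>s. s \<ge> 0 \<and> (?d has_sum s) (Pair D ` queues J)"
      by (rule ballI) (rule nonneg_part)
    from bchoice[OF this] obtain s where
      s: "\<forall>D\<in>Pow {1..J}. s D \<ge> 0 \<and> (?d has_sum s D) (Pair D ` queues J)" ..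
    have "(?d has_sum (\<Sum>D\<in>Pow {1..J}. s D)) (state_space J)"
      unfolding space
    proof (rule sum_has_sum)
      show "(?d has_sum s D) (Pair D ` queues J)" if "D \<in> Pow {1..J}" for D
        using s that by blast
    qed auto
    moreover have "0 \<le> (\<Sum>D\<in>Pow {1..J}. s D)"
      using s by (intro sum_nonneg) blast
    ultimately show "inner_on (state_space J) (stat_Z J mu eta A B) f
          (\<lambda>x. - gen_Z J lam mu A B RD' f x)
        \<le> inner_on (state_space J) (stat_Z J mu eta A B) f (\<lambda>x. - gen_Z J lam mu A B RD f x)"
      by (rule inner_on_le_of_has_sum_diff)
  qed
qed

end
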